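(* Let $(S,\mathcal{A},\mu)$ be a complete, finite measure space, $1\leq p<\infty$ and $X$ a Banach space with the nonstrict Opial property. Let $(f_n)_{n\in\mathbb{N}}$ be a bounded sequence in $L^p(\mu,X)$ such that $(f_n(t))_{n\in\mathbb{N}}$ converges weakly to zero for almost every $t\in S$. Suppose further that there is a function $g\in L^p(\mu)$ such that $\|f_n(t)\|\to g(t)$ for almost every $t\in S$. Then $$\int_A\liminf_{n\to\infty}\|f_n(t)-f(t)\|^p\,\mathrm{d}\mu(t)-\int_A g(t)^p\,\mathrm{d}\mu(t)\leq\limsup_{n\to\infty}\|f_n-f\|_p^p-\limsup_{n\to\infty}\|f_n\|_p^p$$ holds for every $f\in L^p(\mu,X)$ and every $A\in\mathcal{A}$. In particular, $$\limsup_{n\to\infty}\|f_n\|_p\leq\limsup_{n\to\infty}\|f_n-f\|_p\quad\text{for all } f\in L^p(\mu,X).$$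
   Context: All Banach spaces are real. The Lebesgue-Bochner space $L^p(\mu,X)$ is the space of all Bochner-measurable functions $f:S\to X$ (modulo equality $\mu$-almost everywhere) with $\|f(\cdot)\|\in L^p(\mu)$, normed by $\|f\|_p:=\|\,\|f(\cdot)\|\,\|_p$. A Banach space $X$ has the nonstrict Opial property if $\limsup_{n\to\infty}\|x_n\|\leq\limsup_{n\to\infty}\|x_n-x\|$ holds for every weakly null sequence $(x_n)_{n\in\mathbb{N}}$ in $X$ and every $x\in X\setminus\{0\}$ (one may equivalently use $\liminf$ instead of $\limsup$). *)

theory Defs
  imports "HOL-Analysis.Analysis"
begin

text \<open>
  Bochner measurability, i.e. being an almost everywhere limit of simple functions.  The target
  space need not be separable, so this is stronger than mere Borel measurability.
\<close>

definition bochner_measurable :: "'s measure \<Rightarrow> ('s \<Rightarrow> 'a::real_normed_vector) \<Rightarrow> bool" where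
  "bochner_measurable M f \<longleftrightarrow>
     (\<exists>s. (\<forall>k::nat. simple_function M (s k)) \<and> (AE t in M. (\<lambda>k. s k t) \<longlonglongrightarrow> f t))"

text \<open>
  Elements of the Lebesgue-Bochner space are represented by functions, without passing to the
  quotient by almost everywhere equality.
  The scalar space is the instance where the target is \<^typ>\<open>real\<close>.
\<close>

definition Lp_space :: "'s measure \<Rightarrow> real \<Rightarrow> ('s \<Rightarrow> 'a::real_normed_vector) set" where
  "Lp_space M p = {f. bochner_measurable M f \<and> integrable M (\<lambda>t. norm (f t) powr p)}"

definition Lp_norm :: "'s measure \<Rightarrow> real \<Rightarrow> ('s \<Rightarrow> 'a::real_normed_vector) \<Rightarrow> real" where
  "Lp_norm M p f = (\<integral>t. norm (f t) powr p \<partial>M) powr (1 / p)"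

definition weakly_null :: "(nat \<Rightarrow> 'a::real_normed_vector) \<Rightarrow> bool" where
  "weakly_null x \<longleftrightarrow> (\<forall>\<phi>::'a \<Rightarrow> real. bounded_linear \<phi> \<longrightarrow> (\<lambda>n. \<phi> (x n)) \<longlonglongrightarrow> 0)"

definition nonstrict_opial :: "'a::banach itself \<Rightarrow> bool" where
  "nonstrict_opial _ \<longleftrightarrow>
     (\<forall>(x::nat \<Rightarrow> 'a) y. weakly_null x \<longrightarrow> y \<noteq> 0 \<longrightarrow>
        limsup (\<lambda>n. ereal (norm (x n))) \<le> limsup (\<lambda>n. ereal (norm (x n - y))))"

end

theory Submission
  imports Defs
begin

text \<open>
  The inequality is a one-sided Brezis--Lieb lemma followed by a pointwise use of the Opial property.
  Write \<open>u\<^sub>n = \<parallel>f\<^sub>n\<parallel>\<^sup>p\<close> and \<open>v\<^sub>n = \<parallel>f\<^sub>n - h\<parallel>\<^sup>p\<close>, so that \<open>u\<^sub>n\<close> tends to \<open>g\<^sup>p\<close> almost everywhere.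

  For every \<open>c < 1\<close> the triangle inequality gives a constant \<open>D\<close> such that
  \<open>w\<^sub>n = v\<^sub>n + D \<parallel>h\<parallel>\<^sup>p - c u\<^sub>n\<close> is nonnegative (\<open>powr_le_powr_add_powr\<close>).  Fatou's lemma for \<open>w\<^sub>n\<close>
  is more precise than Fatou's lemma for \<open>v\<^sub>n\<close>: since \<open>u\<^sub>n\<close> converges pointwise, it yields
  \<open>\<integral> liminf v\<^sub>n - c \<integral> g\<^sup>p \<le> liminf (\<integral> v\<^sub>n - c \<integral> u\<^sub>n)\<close>, where the terms with \<open>D\<close> have cancelled.  So the mass that
  \<open>u\<^sub>n\<close> loses in the limit is lost by \<open>v\<^sub>n\<close> as well.  Letting \<open>c\<close> tend to 1 and passing to subsequences
  gives (\<open>brezis_lieb_liminf\<close>)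
  \<open>\<integral> (liminf v\<^sub>n - g\<^sup>p) \<le> limsup \<parallel>f\<^sub>n - h\<parallel>\<^sub>p\<^sup>p - limsup \<parallel>f\<^sub>n\<parallel>\<^sub>p\<^sup>p\<close>,
  where the integral is over the whole space and the space of values is arbitrary.

  The Opial property enters only now: it makes \<open>liminf v\<^sub>n - g\<^sup>p\<close> nonnegative almost everywhere
  (\<open>nonstrict_opial_liminf_powr\<close>), so that restricting the integral to a measurable set \<open>A\<close> can only
  decrease it.  The inequality between the norms is the case \<open>A = {}\<close>.
\<close>

section \<open>Bochner measurability in a complete measure space\<close>

text \<open>
  A Bochner measurable function is an almost everywhere limit only; completeness is what turns
  equality almost everywhere with a Borel function into Borel measurability.  Composing with a
  real-valued function first keeps the limit in a separable space.
\<close>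

lemma bochner_measurable_continuous_compose:
  fixes f :: "'s \<Rightarrow> 'a::real_normed_vector" and \<phi> :: "'a \<Rightarrow> real"
  assumes M: "complete_measure M" and f: "bochner_measurable M f" and \<phi>: "continuous_on UNIV \<phi>"
  shows "(\<lambda>t. \<phi> (f t)) \<in> borel_measurable M"
proof -
  interpret complete_measure M by fact
  obtain s where s: "\<And>k::nat. simple_function M (s k)" and lim: "AE t in M. (\<lambda>k. s k t) \<longlonglongrightarrow> f t"
    using f unfolding bochner_measurable_def by blast
  define F where "F = (\<lambda>t. lim (\<lambda>k. \<phi> (s k t)))"
  have "(\<lambda>t. \<phi> (s k t)) \<in> borel_measurable M" for k
    by (rule borel_measurable_simple_function, rule simple_function_compose1[OF s])
  then have F: "F \<in> borel_measurable M"
    unfolding F_def by (rule borel_measurable_lim_metric)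
  have FE: "AE t in M. F t = \<phi> (f t)"
    using lim
  proof eventually_elim
    case (elim t)
    have "isCont \<phi> (f t)"
      using \<phi> by (simp add: continuous_on_eq_continuous_at)
    then have "(\<lambda>k. \<phi> (s k t)) \<longlonglongrightarrow> \<phi> (f t)"
      using elim by (rule isCont_tendsto_compose)
    then show ?case unfolding F_def by (rule limI)
  qed
  show ?thesis
  proof (rule measurableI)
    fix B :: "real set" assume B: "B \<in> sets borel"
    show "(\<lambda>t. \<phi> (f t)) -` B \<inter> space M \<in> sets M"
    proof (rule in_sets_AE)
      show "AE t in M. t \<in> F -` B \<inter> space M \<longleftrightarrow> t \<in> (\<lambda>t. \<phi> (f t)) -` B \<inter> space M"
        using FE by eventually_elim auto
      show "F -` B \<inter> space M \<in> sets M" using F B by (rule measurable_sets)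
    qed auto
  qed auto
qed

lemma bochner_measurable_diff:
  assumes "bochner_measurable M f" "bochner_measurable M h"
  shows "bochner_measurable M (\<lambda>t. f t - h t)"
proof -
  obtain s where s: "\<And>k::nat. simple_function M (s k)" "AE t in M. (\<lambda>k. s k t) \<longlonglongrightarrow> f t"
    using assms(1) unfolding bochner_measurable_def by blast
  obtain r where r: "\<And>k::nat. simple_function M (r k)" "AE t in M. (\<lambda>k. r k t) \<longlonglongrightarrow> h t"
    using assms(2) unfolding bochner_measurable_def by blast
  have "simple_function M (\<lambda>t. s k t - r k t)" for k
    using s(1) r(1) by (rule simple_function_compose2)
  moreover have "AE t in M. (\<lambda>k. s k t - r k t) \<longlonglongrightarrow> f t - h t"
    using s(2) r(2) by eventually_elim (rule tendsto_diff)
  ultimately show ?thesis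
    unfolding bochner_measurable_def by (intro exI[of _ "\<lambda>k t. s k t - r k t"]) auto
qed

section \<open>Comparing powers of the norm\<close>

text \<open>
  If \<open>x\<close> is at least \<open>c\<^bsup>1/p\<^esup> a\<close>, then \<open>x\<^sup>p\<close> alone bounds \<open>c a\<^sup>p\<close>; otherwise \<open>b\<close> is at least a fixed
  fraction of \<open>a\<close>.  The factor \<open>c < 1\<close> cannot be replaced by 1 when \<open>p > 1\<close>.
\<close>

lemma powr_le_powr_add_powr:
  fixes p c :: real
  assumes p: "0 < p" and c: "0 < c" "c < 1"
  shows "\<exists>D\<ge>0. \<forall>a b x. 0 \<le> a \<longrightarrow> 0 \<le> b \<longrightarrow> 0 \<le> x \<longrightarrow> a \<le> x + b \<longrightarrow>
    c * a powr p \<le> x powr p + D * b powr p"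
proof -
  define l where "l = c powr (1 / p)"
  have l: "0 < l" "l powr p = c"
    using p c by (auto simp: l_def powr_powr)
  have "l < 1"
    using powr_less_mono2[of "1 / p" c 1] p c by (simp add: l_def)
  note l = l this
  have "c * a powr p \<le> x powr p + (1 / (1 - l)) powr p * b powr p"
    if a: "0 \<le> a" and b: "0 \<le> b" and x: "0 \<le> x" and ax: "a \<le> x + b" for a b x
  proof (cases "l * a \<le> x")
    case True
    have "c * a powr p = (l * a) powr p"
      using l a by (simp add: powr_mult)
    also have "\<dots> \<le> x powr p"
      using True l a p by (intro powr_mono2) auto
    finally show ?thesis by (simp add: add_increasing2)
  next
    case False
    then have "(1 - l) * a \<le> b" using ax by (simp add: algebra_simps)
    then have ab: "a \<le> 1 / (1 - l) * b" using l by (simp add: field_simps)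
    have "c * a powr p \<le> a powr p"
      using c by (simp add: mult_left_le_one_le)
    also have "\<dots> \<le> (1 / (1 - l) * b) powr p"
      using ab a p by (intro powr_mono2) auto
    also have "\<dots> = (1 / (1 - l)) powr p * b powr p"
      by (rule powr_mult)
    finally show ?thesis by (simp add: add_increasing)
  qed
  then show ?thesis by (intro exI[of _ "(1 / (1 - l)) powr p"]) auto
qed

lemma Lp_space_diff:
  fixes f h :: "'s \<Rightarrow> 'a::real_normed_vector"
  assumes M: "complete_measure M" and p: "0 < p" and f: "f \<in> Lp_space M p" and h: "h \<in> Lp_space M p"
  shows "(\<lambda>t. f t - h t) \<in> Lp_space M p"
proof -
  have bd: "bochner_measurable M (\<lambda>t. f t - h t)"
    using f h by (auto simp: Lp_space_def intro: bochner_measurable_diff)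
  have "(\<lambda>t. norm (f t - h t)) \<in> borel_measurable M"
    using M bd by (rule bochner_measurable_continuous_compose) (intro continuous_intros)
  then have meas: "(\<lambda>t. norm (f t - h t) powr p) \<in> borel_measurable M" by measurable
  obtain D where D: "0 \<le> D" and ineq: "\<And>a b x :: real. 0 \<le> a \<Longrightarrow> 0 \<le> b \<Longrightarrow> 0 \<le> x \<Longrightarrow> a \<le> x + b \<Longrightarrow>
      1/2 * a powr p \<le> x powr p + D * b powr p"
    using powr_le_powr_add_powr[OF p, of "1/2"] by auto
  have "integrable M (\<lambda>t. norm (f t - h t) powr p)"
  proof (rule Bochner_Integration.integrable_bound[OF _ meas])
    show "integrable M (\<lambda>t. 2 * (norm (f t) powr p + D * norm (h t) powr p))"
      using f h by (auto simp: Lp_space_def)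
    have "norm (f t - h t) powr p \<le> 2 * (norm (f t) powr p + D * norm (h t) powr p)" for t
      using ineq[of "norm (f t - h t)" "norm (h t)" "norm (f t)"] norm_triangle_ineq4[of "f t" "h t"]
      by auto
    then show "AE t in M. norm (norm (f t - h t) powr p)
        \<le> norm (2 * (norm (f t) powr p + D * norm (h t) powr p))"
      using D by simp
  qed
  then show ?thesis using bd by (simp add: Lp_space_def)
qed

lemma Lp_norm_powr:
  assumes "0 < p"
  shows "Lp_norm M p f powr p = (\<integral>t. norm (f t) powr p \<partial>M)"
  using assms by (simp add: Lp_norm_def powr_powr)

section \<open>The pointwise consequence of the Opial property\<close>

text \<open>
  The property is formulated with the upper limit.  It improves to the lower limit by applying it to
  a subsequence that realises the lower limit, because the norms of the sequence itself converge.
\<close>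

lemma nonstrict_opial_liminf:
  fixes x :: "nat \<Rightarrow> 'a::banach"
  assumes X: "nonstrict_opial TYPE('a)" and x: "weakly_null x"
    and lim: "(\<lambda>n. norm (x n)) \<longlonglongrightarrow> a"
  shows "ereal a \<le> liminf (\<lambda>n. ereal (norm (x n - y)))"
proof (cases "y = 0")
  case True
  have "liminf (\<lambda>n. ereal (norm (x n))) = ereal a"
    using lim by (intro lim_imp_Liminf) auto
  then show ?thesis using True by simp
next
  case False
  define d where "d = (\<lambda>n. ereal (norm (x n - y)))"
  obtain r where r: "strict_mono r" "(d \<circ> r) \<longlonglongrightarrow> liminf d"
    using liminf_subseq_lim by blast
  have "weakly_null (x \<circ> r)"
    using x LIMSEQ_subseq_LIMSEQ[OF _ r(1)] unfolding weakly_null_def o_def by blast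
  then have "limsup (\<lambda>n. ereal (norm ((x \<circ> r) n))) \<le> limsup (\<lambda>n. ereal (norm ((x \<circ> r) n - y)))"
    using X False unfolding nonstrict_opial_def by blast
  moreover have "limsup (\<lambda>n. ereal (norm ((x \<circ> r) n))) = ereal a"
    using LIMSEQ_subseq_LIMSEQ[OF lim r(1)] by (intro lim_imp_Limsup) (auto simp: o_def)
  moreover have "limsup (\<lambda>n. ereal (norm ((x \<circ> r) n - y))) = liminf d"
    using r(2) by (intro lim_imp_Limsup) (auto simp: o_def d_def)
  ultimately show ?thesis by (simp add: d_def)
qed

text \<open>
  Every \<open>b < a\<close> lies below \<open>norm (x n - y)\<close> for all large \<open>n\<close>, where powers can be compared term by
  term.  This may fail for \<open>b = a\<close> itself, which is reached by continuity.
\<close>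

lemma nonstrict_opial_liminf_powr:
  fixes x :: "nat \<Rightarrow> 'a::banach"
  assumes X: "nonstrict_opial TYPE('a)" and x: "weakly_null x"
    and lim: "(\<lambda>n. norm (x n)) \<longlonglongrightarrow> a" and p: "0 < p"
  shows "ennreal (a powr p) \<le> liminf (\<lambda>n. ennreal (norm (x n - y) powr p))"
proof -
  have a: "0 \<le> a" using lim by (rule LIMSEQ_le_const) auto
  have "ennreal (b powr p) \<le> liminf (\<lambda>n. ennreal (norm (x n - y) powr p))" if b: "0 \<le> b" "b < a" for b
  proof (rule Liminf_bounded)
    have "ereal b < liminf (\<lambda>n. ereal (norm (x n - y)))"
      using nonstrict_opial_liminf[OF X x lim, of y] b by (auto intro: less_le_trans[of _ "ereal a"])
    then have "eventually (\<lambda>n. ereal b < ereal (norm (x n - y))) sequentially"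
      by (rule less_LiminfD)
    then show "eventually (\<lambda>n. ennreal (b powr p) \<le> ennreal (norm (x n - y) powr p)) sequentially"
      by eventually_elim (use b p in \<open>auto intro!: ennreal_leI powr_mono2\<close>)
  qed
  note below = this
  show ?thesis
  proof (cases "a = 0")
    case True
    then show ?thesis by simp
  next
    case False
    with a have a: "0 < a" by simp
    show ?thesis
    proof (rule tendsto_upperbound)
      show "((\<lambda>b. ennreal (b powr p)) \<longlongrightarrow> ennreal (a powr p)) (at_left a)"
        using a by (intro tendsto_ennrealI tendsto_intros) auto
      show "\<forall>\<^sub>F b in at_left a. ennreal (b powr p) \<le> liminf (\<lambda>n. ennreal (norm (x n - y) powr p))"
        using below eventually_at_left_real[OF a] by (auto elim!: eventually_mono)
    qed simp
  qed
qed

section \<open>Fatou's lemma with the lost mass\<close>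

lemma liminf_add_tendsto_le:
  fixes x y :: "nat \<Rightarrow> ennreal"
  assumes y: "y \<longlonglongrightarrow> l"
  shows "liminf (\<lambda>n. x n + y n) \<le> liminf x + l"
proof -
  obtain r where r: "strict_mono r" "(x \<circ> r) \<longlonglongrightarrow> liminf x"
    using liminf_subseq_lim by blast
  have "(y \<circ> r) \<longlonglongrightarrow> l" using y r(1) by (rule LIMSEQ_subseq_LIMSEQ)
  with r(2) have "(\<lambda>n. (x \<circ> r) n + (y \<circ> r) n) \<longlonglongrightarrow> liminf x + l"
    by (rule tendsto_add)
  then have "liminf ((\<lambda>n. x n + y n) \<circ> r) = liminf x + l"
    by (intro lim_imp_Liminf) (auto simp: o_def)
  then show ?thesis
    using liminf_subseq_mono[OF r(1), of "\<lambda>n. x n + y n"] by simp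
qed

text \<open>
  This is the analytic core: the integral of the pointwise lower limit of \<open>v\<close> falls short of \<open>V\<close> by at
  least the mass \<open>U - \<integral> G\<close> that \<open>u\<close> loses in the limit.  The two losses are comparable because \<open>v\<close>
  dominates every \<open>c u\<close> with \<open>c < 1\<close> up to a multiple of one fixed integrable function, and a fixed
  integrable function loses no mass.
\<close>

lemma nn_integral_liminf_add_le:
  fixes u v :: "nat \<Rightarrow> 's \<Rightarrow> real" and G b :: "'s \<Rightarrow> real"
  assumes int: "\<And>n. integrable M (u n)" "\<And>n. integrable M (v n)" "integrable M b" "integrable M G"
    and nonneg: "\<And>n t. 0 \<le> u n t" "\<And>n t. 0 \<le> v n t" "\<And>t. 0 \<le> b t" "\<And>t. 0 \<le> G t"
    and conv: "AE t in M. (\<lambda>n. u n t) \<longlonglongrightarrow> G t"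
    and U: "(\<lambda>n. \<integral>t. u n t \<partial>M) \<longlonglongrightarrow> U" and V: "(\<lambda>n. \<integral>t. v n t \<partial>M) \<longlonglongrightarrow> V"
    and dom: "\<And>c. 0 < c \<Longrightarrow> c < 1 \<Longrightarrow> \<exists>D\<ge>0. \<forall>n t. c * u n t \<le> v n t + D * b t"
  shows "(\<integral>\<^sup>+t. liminf (\<lambda>n. ennreal (v n t)) \<partial>M) + ennreal U \<le> ennreal V + ennreal (\<integral>t. G t \<partial>M)"
proof -
  note [measurable] = int[THEN borel_measurable_integrable]
  define I where "I = (\<integral>\<^sup>+t. liminf (\<lambda>n. ennreal (v n t)) \<partial>M)"
  define J where "J = (\<integral>t. G t \<partial>M)"
  have U0: "0 \<le> U" using U by (rule LIMSEQ_le_const) (auto simp: nonneg)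
  have V0: "0 \<le> V" using V by (rule LIMSEQ_le_const) (auto simp: nonneg)
  have J0: "0 \<le> J" by (simp add: J_def nonneg)
  have damped: "I + ennreal (c * U) \<le> ennreal V + ennreal (c * J)" if c: "0 < c" "c < 1" for c
  proof -
    obtain D where D: "0 \<le> D" and ineq: "\<And>n t. c * u n t \<le> v n t + D * b t"
      using dom[OF c] by blast
    define B where "B = D * (\<integral>t. b t \<partial>M)"
    have B0: "0 \<le> B" by (simp add: B_def nonneg D)
    \<comment> \<open>Fatou's lemma is applied to this nonnegative function; the convergent part \<open>c u\<close> is added back
      pointwise before integrating.\<close>
    define w where "w n t = v n t + D * b t - c * u n t" for n t
    have w0: "0 \<le> w n t" for n t using ineq by (simp add: w_def)
    have wint: "integrable M (w n)" for n unfolding w_def by (intro Bochner_Integration.integrable_add Bochner_Integration.integrable_diff integrable_mult_right int)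
    note [measurable] = wint[THEN borel_measurable_integrable]
    have "(\<integral>t. w n t \<partial>M) = (\<integral>t. v n t \<partial>M) + B - c * (\<integral>t. u n t \<partial>M)" for n
      unfolding w_def B_def using int by simp
    then have wlim: "(\<lambda>n. \<integral>t. w n t \<partial>M) \<longlonglongrightarrow> V + B - c * U"
      by (auto intro!: tendsto_intros U V)
    have W0: "0 \<le> V + B - c * U" using wlim by (rule LIMSEQ_le_const) (auto simp: w0)
    have "I + ennreal B = (\<integral>\<^sup>+t. liminf (\<lambda>n. ennreal (v n t)) + ennreal (D * b t) \<partial>M)"
      unfolding I_def B_def using int D nonneg
      by (subst nn_integral_add) (auto simp: nn_integral_eq_integral)
    also have "\<dots> \<le> (\<integral>\<^sup>+t. liminf (\<lambda>n. ennreal (w n t)) + ennreal (c * G t) \<partial>M)"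
    proof (rule nn_integral_mono_AE, use conv in eventually_elim)
      case (elim t)
      have "liminf (\<lambda>n. ennreal (v n t)) + ennreal (D * b t) = liminf (\<lambda>n. ennreal (v n t) + ennreal (D * b t))"
        by (simp add: Liminf_add_const)
      also have "(\<lambda>n. ennreal (v n t) + ennreal (D * b t)) = (\<lambda>n. ennreal (w n t) + ennreal (c * u n t))"
        using w0 nonneg D c by (simp add: w_def flip: ennreal_plus)
      also have "liminf \<dots> \<le> liminf (\<lambda>n. ennreal (w n t)) + ennreal (c * G t)"
        using elim by (intro liminf_add_tendsto_le tendsto_ennrealI tendsto_intros)
      finally show ?case .
    qed
    also have "\<dots> = (\<integral>\<^sup>+t. liminf (\<lambda>n. ennreal (w n t)) \<partial>M) + ennreal (c * J)"
      unfolding J_def using int c nonneg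
      by (subst nn_integral_add) (auto simp: nn_integral_eq_integral)
    also have "(\<integral>\<^sup>+t. liminf (\<lambda>n. ennreal (w n t)) \<partial>M) \<le> liminf (\<lambda>n. \<integral>\<^sup>+t. ennreal (w n t) \<partial>M)"
      by (rule nn_integral_liminf) measurable
    also have "(\<lambda>n. \<integral>\<^sup>+t. ennreal (w n t) \<partial>M) = (\<lambda>n. ennreal (\<integral>t. w n t \<partial>M))"
      using wint w0 by (simp add: nn_integral_eq_integral)
    also have "liminf \<dots> = ennreal (V + B - c * U)"
      using wlim by (intro lim_imp_Liminf tendsto_ennrealI) auto
    finally have "I + ennreal B + ennreal (c * U) \<le> ennreal (V + B - c * U) + ennreal (c * J) + ennreal (c * U)"
      by (simp add: add_right_mono)
    also have "\<dots> = (ennreal (V + B - c * U) + ennreal (c * U)) + ennreal (c * J)"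
      by (simp only: ac_simps)
    also have "ennreal (V + B - c * U) + ennreal (c * U) = ennreal (V + B)"
      using W0 c U0 by (subst ennreal_plus[symmetric]) auto
    also have "ennreal (V + B) + ennreal (c * J) = ennreal B + (ennreal V + ennreal (c * J))"
      using V0 B0 by (simp add: ac_simps)
    finally have "ennreal B + (I + ennreal (c * U)) \<le> ennreal B + (ennreal V + ennreal (c * J))"
      by (simp add: ac_simps)
    then show ?thesis by (simp add: ennreal_add_left_cancel_le)
  qed
  \<comment> \<open>Any admissible \<open>c\<close>, here \<open>1/2\<close>, shows that \<open>I\<close> is finite, so the limit \<open>c \<rightarrow> 1\<close> is taken over the reals.\<close>
  have "I \<le> I + ennreal (1/2 * U)" by simp
  also have "\<dots> \<le> ennreal V + ennreal (1/2 * J)" by (rule damped) auto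
  also have "\<dots> < top" by simp
  finally obtain i where i: "0 \<le> i" "I = ennreal i" by (cases I) auto
  have real_damped: "i + c * U \<le> V + c * J" if "0 < c" "c < 1" for c
    using damped[OF that] i V0 U0 J0 that by (simp flip: ennreal_plus)
  have "i + 1 * U \<le> V + 1 * J"
  proof (rule tendsto_le)
    show "((\<lambda>c. V + c * J) \<longlongrightarrow> V + 1 * J) (at_left 1)" by (intro tendsto_intros)
    show "((\<lambda>c. i + c * U) \<longlongrightarrow> i + 1 * U) (at_left 1)" by (intro tendsto_intros)
    show "\<forall>\<^sub>F c in at_left 1. i + c * U \<le> V + c * J"
      using real_damped eventually_at_left_real[of 0 1] by (auto elim!: eventually_mono)
  qed simp
  then show ?thesis
    using i V0 U0 J0 unfolding I_def[symmetric] J_def[symmetric] by (simp flip: ennreal_plus)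
qed

section \<open>Upper limits of real sequences\<close>

lemma limsup_le_if_limsup_powr_le:
  fixes a b :: "nat \<Rightarrow> real"
  assumes p: "0 < p" and nonneg: "\<And>n. 0 \<le> a n" "\<And>n. 0 \<le> b n"
    and le: "limsup (\<lambda>n. ereal (a n powr p)) \<le> limsup (\<lambda>n. ereal (b n powr p))"
  shows "limsup (\<lambda>n. ereal (a n)) \<le> limsup (\<lambda>n. ereal (b n))"
proof (rule ccontr)
  assume "\<not> ?thesis"
  then obtain y where y: "limsup (\<lambda>n. ereal (b n)) < ereal y" "ereal y < limsup (\<lambda>n. ereal (a n))"
    using ereal_dense2[of "limsup (\<lambda>n. ereal (b n))"] by (auto simp: not_le)
  then obtain z where z: "ereal y < ereal z" "ereal z < limsup (\<lambda>n. ereal (a n))"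
    using ereal_dense2 by blast
  have ev: "eventually (\<lambda>n. ereal (b n) < ereal y) sequentially"
    using y(1) by (rule Limsup_lessD)
  then obtain n where "b n < y" by (auto dest: eventually_happens)
  then have y0: "0 < y" using nonneg(2)[of n] by simp
  have "limsup (\<lambda>n. ereal (b n powr p)) \<le> ereal (y powr p)"
    by (rule Limsup_bounded, use ev in eventually_elim)
      (use nonneg p in \<open>auto intro!: powr_mono2\<close>)
  with le have "limsup (\<lambda>n. ereal (a n powr p)) \<le> ereal (y powr p)" by (rule order_trans)
  also have "\<dots> < ereal (z powr p)" using z(1) y0 p by (simp add: powr_less_mono2)
  finally have "eventually (\<lambda>n. ereal (a n powr p) < ereal (z powr p)) sequentially"
    by (rule Limsup_lessD)
  then have "eventually (\<lambda>n. ereal (a n) \<le> ereal z) sequentially"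
  proof eventually_elim
    case (elim n)
    show ?case
    proof (rule ccontr)
      assume "\<not> ?thesis"
      then have "z powr p \<le> a n powr p" using p y0 z(1) by (intro powr_mono2) auto
      with elim show False by simp
    qed
  qed
  then have "limsup (\<lambda>n. ereal (a n)) \<le> ereal z" by (rule Limsup_bounded)
  with z(2) show False by simp
qed

lemma limsup_bounded_real_subseq:
  fixes a :: "nat \<Rightarrow> real"
  assumes nonneg: "\<And>n. 0 \<le> a n" and bound: "\<And>n. a n \<le> K"
  obtains r L where "strict_mono r" "(a \<circ> r) \<longlonglongrightarrow> L" "0 \<le> L" "limsup (\<lambda>n. ereal (a n)) = ereal L"
proof -
  have lower: "0 \<le> limsup (\<lambda>n. ereal (a n))"
    by (rule le_Limsup) (auto simp: nonneg)
  moreover have "limsup (\<lambda>n. ereal (a n)) \<le> ereal K"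
    by (rule Limsup_bounded) (auto simp: bound)
  ultimately obtain L where L: "limsup (\<lambda>n. ereal (a n)) = ereal L"
    by (cases "limsup (\<lambda>n. ereal (a n))") auto
  obtain r where r: "strict_mono r" "((\<lambda>n. ereal (a n)) \<circ> r) \<longlonglongrightarrow> limsup (\<lambda>n. ereal (a n))"
    using limsup_subseq_lim by blast
  show thesis
  proof
    show "strict_mono r" by fact
    show "(a \<circ> r) \<longlonglongrightarrow> L" using r(2) by (simp add: L o_def)
    show "0 \<le> L" using lower by (simp add: L)
  qed fact
qed

section \<open>The inequality in the Lebesgue--Bochner space\<close>

text \<open>
  The integrals of \<open>\<parallel>f\<^sub>n\<parallel>\<^sup>p\<close> and \<open>\<parallel>f\<^sub>n - h\<parallel>\<^sup>p\<close> need not converge.  Along a subsequence that realises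
  the upper limit \<open>U\<close> of the former and on which the latter converge as well,
  \<open>nn_integral_liminf_add_le\<close> applies.  Passing to a subsequence can only increase the pointwise lower limit and decrease the upper
  limit \<open>V\<close>, and both changes are in the right direction.
\<close>

lemma brezis_lieb_liminf:
  fixes f :: "nat \<Rightarrow> 's \<Rightarrow> 'a::real_normed_vector" and g :: "'s \<Rightarrow> real"
  assumes M: "complete_measure M" and p: "0 < p"
    and f: "\<And>n. f n \<in> Lp_space M p" and bound: "\<And>n. Lp_norm M p (f n) \<le> C"
    and g: "g \<in> Lp_space M p" and h: "h \<in> Lp_space M p"
    and conv: "AE t in M. (\<lambda>n. norm (f n t)) \<longlonglongrightarrow> g t"
  obtains U V where "0 \<le> U" "0 \<le> V"
    "limsup (\<lambda>n. ereal (Lp_norm M p (f n) powr p)) = ereal U"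
    "limsup (\<lambda>n. ereal (Lp_norm M p (\<lambda>t. f n t - h t) powr p)) = ereal V"
    "(\<integral>\<^sup>+t. liminf (\<lambda>n. ennreal (norm (f n t - h t) powr p)) \<partial>M) + ennreal U
       \<le> ennreal V + (\<integral>\<^sup>+t. ennreal (norm (g t) powr p) \<partial>M)"
proof -
  define u where "u n t = norm (f n t) powr p" for n t
  define v where "v n t = norm (f n t - h t) powr p" for n t
  define b where "b t = norm (h t) powr p" for t
  define G where "G t = norm (g t) powr p" for t
  have int: "integrable M (u n)" "integrable M (v n)" "integrable M b" "integrable M G" for n
    using f[of n] g h Lp_space_diff[OF M p f[of n] h]
    by (auto simp: Lp_space_def u_def[abs_def] v_def[abs_def] b_def[abs_def] G_def[abs_def])
  note [measurable] = int[THEN borel_measurable_integrable]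
  define iu where "iu n = (\<integral>t. u n t \<partial>M)" for n
  define iv where "iv n = (\<integral>t. v n t \<partial>M)" for n
  have iu: "Lp_norm M p (f n) powr p = iu n" for n
    by (simp add: Lp_norm_powr[OF p] iu_def u_def)
  have iv: "Lp_norm M p (\<lambda>t. f n t - h t) powr p = iv n" for n
    by (simp add: Lp_norm_powr[OF p] iv_def v_def)
  have iu_nonneg: "0 \<le> iu n" and iv_nonneg: "0 \<le> iv n" for n
    by (simp_all flip: iu iv)
  have iu_bound: "iu n \<le> C powr p" for n
    unfolding iu[symmetric] using bound[of n] p by (intro powr_mono2) (auto simp: Lp_norm_def)
  obtain E where E: "0 \<le> E" and ineqE: "\<And>a b x :: real. 0 \<le> a \<Longrightarrow> 0 \<le> b \<Longrightarrow> 0 \<le> x \<Longrightarrow> a \<le> x + b \<Longrightarrow>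
      1/2 * a powr p \<le> x powr p + E * b powr p"
    using powr_le_powr_add_powr[OF p, of "1/2"] by auto
  have vle: "v n t \<le> 2 * (u n t + E * b t)" for n t
    using ineqE[of "norm (f n t - h t)" "norm (h t)" "norm (f n t)"] norm_triangle_ineq4[of "f n t" "h t"]
    by (auto simp: u_def v_def b_def)
  have "iv n \<le> 2 * (iu n + E * (\<integral>t. b t \<partial>M))" for n
  proof -
    have "iv n \<le> (\<integral>t. 2 * (u n t + E * b t) \<partial>M)"
      unfolding iv_def using int vle by (intro integral_mono) auto
    also have "\<dots> = 2 * (iu n + E * (\<integral>t. b t \<partial>M))"
      unfolding iu_def using int by simp
    finally show ?thesis .
  qed
  then have iv_bound: "iv n \<le> 2 * (C powr p + E * (\<integral>t. b t \<partial>M))" for n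
    using iu_bound[of n] by (smt (verit))
  obtain r U where r: "strict_mono r" and U: "(iu \<circ> r) \<longlonglongrightarrow> U" "0 \<le> U"
      "limsup (\<lambda>n. ereal (iu n)) = ereal U"
    by (rule limsup_bounded_real_subseq[OF iu_nonneg iu_bound])
  obtain V where V: "0 \<le> V" "limsup (\<lambda>n. ereal (iv n)) = ereal V"
    by (rule limsup_bounded_real_subseq[OF iv_nonneg iv_bound])
  obtain s V' where s: "strict_mono s" and V': "((iv \<circ> r) \<circ> s) \<longlonglongrightarrow> V'"
      "limsup (\<lambda>n. ereal ((iv \<circ> r) n)) = ereal V'"
    by (rule limsup_bounded_real_subseq[of "iv \<circ> r"]) (use iv_nonneg iv_bound in auto)
  have "ereal V' \<le> ereal V"
    using limsup_subseq_mono[OF r, of "\<lambda>n. ereal (iv n)"] V'(2) V(2) by (simp add: o_def)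
  then have V'V: "V' \<le> V" by simp
  define q where "q = r \<circ> s"
  have q: "strict_mono q" unfolding q_def using r s by (rule strict_mono_o)
  have "(\<integral>\<^sup>+t. liminf (\<lambda>n. ennreal (v n t)) \<partial>M) + ennreal U
      \<le> (\<integral>\<^sup>+t. liminf (\<lambda>n. ennreal (v (q n) t)) \<partial>M) + ennreal U"
    using liminf_subseq_mono[OF q, of "\<lambda>n. ennreal (v n t)" for t]
    by (intro add_right_mono nn_integral_mono) (simp add: o_def)
  also have "\<dots> \<le> ennreal V' + ennreal (\<integral>t. G t \<partial>M)"
  proof (rule nn_integral_liminf_add_le)
    show "AE t in M. (\<lambda>n. u (q n) t) \<longlonglongrightarrow> G t"
      using conv
    proof eventually_elim
      case (elim t)
      have "0 \<le> g t" using elim by (rule LIMSEQ_le_const) auto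
      moreover have "(\<lambda>n. norm (f (q n) t)) \<longlonglongrightarrow> g t"
        using LIMSEQ_subseq_LIMSEQ[OF elim q] by (simp add: o_def)
      ultimately show ?case
        unfolding u_def G_def using p by (auto intro!: tendsto_powr2 tendsto_intros)
    qed
    show "(\<lambda>n. \<integral>t. u (q n) t \<partial>M) \<longlonglongrightarrow> U"
      using LIMSEQ_subseq_LIMSEQ[OF U(1) s] by (simp add: o_def q_def iu_def)
    show "(\<lambda>n. \<integral>t. v (q n) t \<partial>M) \<longlonglongrightarrow> V'"
      using V'(1) by (simp add: o_def q_def iv_def)
    fix c :: real assume c: "0 < c" "c < 1"
    obtain D where D: "0 \<le> D" and ineq: "\<And>a b x :: real. 0 \<le> a \<Longrightarrow> 0 \<le> b \<Longrightarrow> 0 \<le> x \<Longrightarrow> a \<le> x + b \<Longrightarrow>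
        c * a powr p \<le> x powr p + D * b powr p"
      using powr_le_powr_add_powr[OF p c] by auto
    have "c * u (q n) t \<le> v (q n) t + D * b t" for n t
      unfolding u_def v_def b_def
      using norm_triangle_ineq[of "f (q n) t - h t" "h t"] by (intro ineq) auto
    then show "\<exists>D\<ge>0. \<forall>n t. c * u (q n) t \<le> v (q n) t + D * b t"
      using D by blast
  qed (auto simp: int, auto simp: u_def v_def b_def G_def)
  also have "\<dots> \<le> ennreal V + (\<integral>\<^sup>+t. ennreal (G t) \<partial>M)"
    using V'V nn_integral_eq_integral[OF int(4)]
    by (auto simp: G_def[abs_def] intro!: add_mono ennreal_leI)
  finally have "(\<integral>\<^sup>+t. liminf (\<lambda>n. ennreal (v n t)) \<partial>M) + ennreal U
      \<le> ennreal V + (\<integral>\<^sup>+t. ennreal (G t) \<partial>M)" .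
  then show thesis
    using U V by (intro that[of U V]) (auto simp: iu iv v_def G_def)
qed

theorem proposition4p1:
  fixes M :: "'s measure" and p :: real
    and f :: "nat \<Rightarrow> 's \<Rightarrow> 'a::banach" and g :: "'s \<Rightarrow> real"
  assumes "complete_measure M" and "finite_measure M"
    and "1 \<le> p"
    and "nonstrict_opial TYPE('a)"
    and "\<And>n. f n \<in> Lp_space M p"
    and "\<exists>C. \<forall>n. Lp_norm M p (f n) \<le> C"
    and "AE t in M. weakly_null (\<lambda>n. f n t)"
    and "g \<in> Lp_space M p"
    and "AE t in M. (\<lambda>n. norm (f n t)) \<longlonglongrightarrow> g t"
  shows "(\<forall>h \<in> Lp_space M p. \<forall>A \<in> sets M.
            enn2ereal (\<integral>\<^sup>+t\<in>A. liminf (\<lambda>n. ennreal (norm (f n t - h t) powr p)) \<partial>M)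
              - ereal (LINT t:A|M. g t powr p)
            \<le> limsup (\<lambda>n. ereal (Lp_norm M p (\<lambda>t. f n t - h t) powr p))
              - limsup (\<lambda>n. ereal (Lp_norm M p (f n) powr p)))
       \<and> (\<forall>h \<in> Lp_space M p.
            limsup (\<lambda>n. ereal (Lp_norm M p (f n)))
            \<le> limsup (\<lambda>n. ereal (Lp_norm M p (\<lambda>t. f n t - h t))))"
proof -
  have p: "0 < p" using \<open>1 \<le> p\<close> by simp
  note M = \<open>complete_measure M\<close>
  note f = \<open>\<And>n. f n \<in> Lp_space M p\<close> and g = \<open>g \<in> Lp_space M p\<close>
  note conv = \<open>AE t in M. (\<lambda>n. norm (f n t)) \<longlonglongrightarrow> g t\<close>
  obtain C where C: "\<And>n. Lp_norm M p (f n) \<le> C"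
    using \<open>\<exists>C. \<forall>n. Lp_norm M p (f n) \<le> C\<close> by blast
  define G where "G = (\<lambda>t. norm (g t) powr p)"
  have G: "integrable M G" using g by (simp add: Lp_space_def G_def)
  have gmeas: "g \<in> borel_measurable M"
    using bochner_measurable_continuous_compose[OF M, of g "\<lambda>x. x"] g by (simp add: Lp_space_def)
  note [measurable] = gmeas borel_measurable_integrable[OF G]
  have gG: "AE t in M. g t powr p = G t"
    using conv
  proof eventually_elim
    case (elim t)
    have "0 \<le> g t" using elim by (rule LIMSEQ_le_const) auto
    then show ?case by (simp add: G_def)
  qed
  have difference: "enn2ereal (\<integral>\<^sup>+t\<in>A. liminf (\<lambda>n. ennreal (norm (f n t - h t) powr p)) \<partial>M)
              - ereal (LINT t:A|M. g t powr p)
            \<le> limsup (\<lambda>n. ereal (Lp_norm M p (\<lambda>t. f n t - h t) powr p))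
              - limsup (\<lambda>n. ereal (Lp_norm M p (f n) powr p))"
    if h: "h \<in> Lp_space M p" and A: "A \<in> sets M" for h A
  proof -
    define l where "l t = liminf (\<lambda>n. ennreal (norm (f n t - h t) powr p))" for t
    have [measurable]: "l \<in> borel_measurable M" "A \<in> sets M"
    proof -
      have [measurable]: "(\<lambda>t. norm (f n t - h t) powr p) \<in> borel_measurable M" for n
        using Lp_space_diff[OF M p f h, of n] by (auto simp: Lp_space_def)
      show "l \<in> borel_measurable M" unfolding l_def[abs_def] by measurable
    qed fact
    obtain U V where UV: "0 \<le> U" "0 \<le> V"
      "limsup (\<lambda>n. ereal (Lp_norm M p (f n) powr p)) = ereal U"
      "limsup (\<lambda>n. ereal (Lp_norm M p (\<lambda>t. f n t - h t) powr p)) = ereal V"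
      and le: "(\<integral>\<^sup>+t. l t \<partial>M) + ennreal U \<le> ennreal V + (\<integral>\<^sup>+t. ennreal (G t) \<partial>M)"
      unfolding l_def G_def by (rule brezis_lieb_liminf[OF M p f C g h conv])
    have Gl: "AE t in M. ennreal (G t) \<le> l t"
      using conv \<open>AE t in M. weakly_null (\<lambda>n. f n t)\<close> gG
    proof eventually_elim
      case (elim t)
      then show ?case
        using nonstrict_opial_liminf_powr[OF \<open>nonstrict_opial TYPE('a)\<close> elim(2,1) p, of "h t"]
        by (simp add: l_def)
    qed
    have split: "(\<integral>\<^sup>+t. k t \<partial>M) = (\<integral>\<^sup>+t\<in>A. k t \<partial>M) + (\<integral>\<^sup>+t\<in>space M - A. k t \<partial>M)"
      if [measurable]: "k \<in> borel_measurable M" for k :: "'s \<Rightarrow> ennreal"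
      by (subst nn_integral_add[symmetric]) 
        (auto intro!: nn_integral_cong split: split_indicator)
    \<comment> \<open>Off \<open>A\<close> the lower limit is bounded below by \<open>G\<close>; this common part \<open>R\<close> is finite and cancels.\<close>
    define R where "R = (\<integral>\<^sup>+t\<in>space M - A. ennreal (G t) \<partial>M)"
    have R: "R \<noteq> top"
    proof -
      have "R \<le> (\<integral>\<^sup>+t. ennreal (G t) \<partial>M)"
        unfolding R_def by (intro nn_integral_mono) (auto split: split_indicator)
      also have "\<dots> < top"
        using G by (simp add: nn_integral_eq_integral G_def)
      finally show ?thesis by simp
    qed
    have "R + ((\<integral>\<^sup>+t\<in>A. l t \<partial>M) + ennreal U) \<le> (\<integral>\<^sup>+t. l t \<partial>M) + ennreal U"
    proof -
      have "R \<le> (\<integral>\<^sup>+t\<in>space M - A. l t \<partial>M)"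
        unfolding R_def by (rule nn_integral_mono_AE) (use Gl in eventually_elim, auto split: split_indicator)
      then show ?thesis
        unfolding split[OF \<open>l \<in> borel_measurable M\<close>] by (simp add: ac_simps add_mono)
    qed
    also note le
    also have "ennreal V + (\<integral>\<^sup>+t. ennreal (G t) \<partial>M) = R + (ennreal V + (\<integral>\<^sup>+t\<in>A. ennreal (G t) \<partial>M))"
      by (subst split) (auto simp: R_def ac_simps)
    finally have "(\<integral>\<^sup>+t\<in>A. l t \<partial>M) + ennreal U \<le> ennreal V + (\<integral>\<^sup>+t\<in>A. ennreal (G t) \<partial>M)"
      using R by (simp add: ennreal_add_left_cancel_le)
    also have "(\<integral>\<^sup>+t\<in>A. ennreal (G t) \<partial>M) = ennreal (LINT t:A|M. g t powr p)"
    proof -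
      have "(LINT t:A|M. g t powr p) = (\<integral>t. indicator A t * G t \<partial>M)"
        unfolding set_lebesgue_integral_def using gG
        by (intro integral_cong_AE) auto
      moreover have "integrable M (\<lambda>t. indicator A t * G t)"
        using integrable_mult_indicator[OF A G] by simp
      moreover have "(\<integral>\<^sup>+t\<in>A. ennreal (G t) \<partial>M) = (\<integral>\<^sup>+t. ennreal (indicator A t * G t) \<partial>M)"
        by (intro nn_integral_cong) (auto split: split_indicator)
      ultimately show ?thesis by (simp add: nn_integral_eq_integral G_def)
    qed
    finally have fin: "(\<integral>\<^sup>+t\<in>A. l t \<partial>M) + ennreal U \<le> ennreal V + ennreal (LINT t:A|M. g t powr p)" .
    have I0: "0 \<le> (LINT t:A|M. g t powr p)"
      unfolding set_lebesgue_integral_def by (rule integral_nonneg_AE) auto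
    have "(\<integral>\<^sup>+t\<in>A. l t \<partial>M) \<le> (\<integral>\<^sup>+t\<in>A. l t \<partial>M) + ennreal U" by simp
    also note fin
    also have "ennreal V + ennreal (LINT t:A|M. g t powr p) < top" by simp
    finally obtain i where i: "0 \<le> i" "(\<integral>\<^sup>+t\<in>A. l t \<partial>M) = ennreal i"
      by (cases "\<integral>\<^sup>+t\<in>A. l t \<partial>M") auto
    have "i + U \<le> V + (LINT t:A|M. g t powr p)"
      using fin i I0 UV(1,2) by (simp flip: ennreal_plus)
    then show ?thesis
      using i unfolding l_def UV(3,4) by simp
  qed
  have "limsup (\<lambda>n. ereal (Lp_norm M p (f n))) \<le> limsup (\<lambda>n. ereal (Lp_norm M p (\<lambda>t. f n t - h t)))"
    if h: "h \<in> Lp_space M p" for h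
  proof (rule limsup_le_if_limsup_powr_le[OF p])
    obtain U V where UV:
      "limsup (\<lambda>n. ereal (Lp_norm M p (f n) powr p)) = ereal U"
      "limsup (\<lambda>n. ereal (Lp_norm M p (\<lambda>t. f n t - h t) powr p)) = ereal V"
      by (rule brezis_lieb_liminf[OF M p f C g h conv])
    have "0 \<le> ereal V - ereal U"
      using difference[OF h, of "{}"] unfolding UV by (simp add: set_lebesgue_integral_def zero_ennreal.rep_eq)
    then show "limsup (\<lambda>n. ereal (Lp_norm M p (f n) powr p))
        \<le> limsup (\<lambda>n. ereal (Lp_norm M p (\<lambda>t. f n t - h t) powr p))"
      unfolding UV by simp
  qed (auto simp: Lp_norm_def)
  with difference show ?thesis by blast
qed

end
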